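(* Let $A\in\{0,1\}^{m\times n}$ satisfy the standing assumptions, and let $v$ and $v'$ be two distinct vertices of $Q^*(A)$. If the joint saturation graph $\mathcal{G}_A(v,v')$ is partite-connected, then $v$ and $v'$ are adjacent in $Q^*(A)$.
   Context: For $A\in\{0,1\}^{m\times n}$, the set covering polyhedron is $Q^*(A)=\operatorname{conv}\{x\in\mathbb{Z}^n\mid Ax\ge\mathbf{1},\ x\ge\mathbf{0}\}$. Standing assumptions on $A$: it has no dominating rows (no row is componentwise $\ge$ another row with a different index), each row has between $2$ and $n-1$ ones, and no column is all ones or all zeroes. $\operatorname{supp}x=\{i\mid x_i\ne 0\}$. Let $C_t$ be the support of the $t$-th row of $A$ and $\mathcal{C}=\{C_1,\dots,C_m\}$. Two vertices of a polyhedron are adjacent if the segment joining them is an edge (one-dimensional face). Joint saturation graph: for distinct vertices $v,v'$ of $Q^*(A)$ (these are $0/1$ vectors), $\mathcal{G}_A(v,v')$ is the simple undirected bipartite graph with partite sets $\operatorname{supp}v\setminus\operatorname{supp}v'$ and $\operatorname{supp}v'\setminus\operatorname{supp}v$, where $p\in\operatorname{supp}v\setminus\operatorname{supp}v'$ and $p'\in\operatorname{supp}v'\setminus\operatorname{supp}v$ are neighbors if and only if there is $C_t\in\mathcal{C}$ with $C_t\cap\operatorname{supp}v=\{p\}$ and $C_t\cap\operatorname{supp}v'=\{p'\}$. A bipartite graph (with given partite sets) is partite-connected if one of its partite sets is contained in a (connected) component. *)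

theory Defs
  imports "HOL-Analysis.Analysis"
begin

text \<open>An \<open>m \<times> n\<close> matrix is a \<open>real ^ 'n ^ 'm\<close> with \<open>m = CARD('m)\<close> and \<open>n = CARD('n)\<close>. Types are
  nonempty, so \<open>m, n \<ge> 1\<close>; this loses nothing, as the standing assumptions on rows and columns
  cannot be met when exactly one of \<open>m, n\<close> is 0, and \<open>n = 0\<close> leaves no two distinct
  vertices. The order on vectors is componentwise, and \<open>1\<close> is the all-ones vector.\<close>

definition zero_one_matrix :: "real ^ 'n ^ 'm \<Rightarrow> bool" where
  "zero_one_matrix A \<longleftrightarrow> (\<forall>t j. A $ t $ j \<in> {0, 1})"

definition supp :: "real ^ 'n \<Rightarrow> 'n set" where
  "supp x = {i. x $ i \<noteq> 0}"

definition row_supports :: "real ^ 'n ^ 'm \<Rightarrow> 'n set set" where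
  "row_supports A = {supp (row t A) |t. True}"

definition standing_assumptions :: "real ^ 'n ^ 'm \<Rightarrow> bool" where
  "standing_assumptions A \<longleftrightarrow>
     (\<forall>s t. s \<noteq> t \<longrightarrow> \<not> row s A \<le> row t A) \<and>
     (\<forall>t. 2 \<le> card (supp (row t A)) \<and> card (supp (row t A)) \<le> CARD('n) - 1) \<and>
     (\<forall>j. column j A \<noteq> 1 \<and> column j A \<noteq> 0)"

definition set_covering_polyhedron :: "real ^ 'n ^ 'm \<Rightarrow> (real ^ 'n) set" where
  "set_covering_polyhedron A =
     convex hull {x. (\<forall>i. x $ i \<in> \<int>) \<and> A *v x \<ge> 1 \<and> x \<ge> 0}"

definition adjacent_vertices :: "'a::euclidean_space set \<Rightarrow> 'a \<Rightarrow> 'a \<Rightarrow> bool" where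
  "adjacent_vertices P v w \<longleftrightarrow>
     v extreme_point_of P \<and> w extreme_point_of P \<and> closed_segment v w edge_of P"

text \<open>A simple undirected graph is given by its vertex set and a symmetric irreflexive adjacency
  relation on it.\<close>

definition connected_components :: "'a set \<Rightarrow> 'a rel \<Rightarrow> 'a set set" where
  "connected_components V E = V // {(x, y) \<in> V \<times> V. (x, y) \<in> E\<^sup>*}"

definition partite_connected :: "'a set \<Rightarrow> 'a set \<Rightarrow> 'a rel \<Rightarrow> bool" where
  "partite_connected X Y E \<longleftrightarrow>
     (\<exists>K \<in> connected_components (X \<union> Y) E. X \<subseteq> K \<or> Y \<subseteq> K)"

definition joint_saturation_pairs ::
    "real ^ 'n ^ 'm \<Rightarrow> real ^ 'n \<Rightarrow> real ^ 'n \<Rightarrow> 'n rel" where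
  "joint_saturation_pairs A v v' =
     {(p, p'). p \<in> supp v - supp v' \<and> p' \<in> supp v' - supp v \<and>
        (\<exists>C \<in> row_supports A. C \<inter> supp v = {p} \<and> C \<inter> supp v' = {p'})}"

text \<open>The symmetric closure makes the graph undirected.\<close>

definition joint_saturation_edges ::
    "real ^ 'n ^ 'm \<Rightarrow> real ^ 'n \<Rightarrow> real ^ 'n \<Rightarrow> 'n rel" where
  "joint_saturation_edges A v v' =
     joint_saturation_pairs A v v' \<union> (joint_saturation_pairs A v v')\<inverse>"

end

theory Submission
  imports Defs
begin

text \<open>Write \<open>S\<close> for the integer points \<open>z \<ge> 0\<close> with \<open>A z \<ge> 1\<close>, so that the polyhedron is the
  convex hull of \<open>S\<close>, and let \<open>X = supp v - supp v'\<close> and \<open>Y = supp v' - supp v\<close>; by symmetry let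
  \<open>X\<close> be the partite set lying in one component. The idea is to start from \<open>S\<close> and to pass
  repeatedly to the points at which some inequalities valid on the current set hold with equality,
  until only \<open>v\<close> and \<open>v'\<close> are left. Each step gives a face of the previous hull
  (\<open>convex_hull_equality_face_of\<close>), so at the end the segment from \<open>v\<close> to \<open>v'\<close> is a face.

  Membership in \<open>S\<close> of a nonnegative integer vector depends only on its support, and it is
  inherited by larger supports. As a vertex \<open>v\<close> is not a midpoint of points of \<open>S\<close>, none of its
  positive entries can be lowered by one; hence \<open>v\<close> is a \<open>0/1\<close> vector, and every \<open>z \<in> S\<close> with
  support inside \<open>supp v\<close> satisfies \<open>v \<le> z\<close> (\<open>vertex_le_of_supp_subset\<close>).

  The steps are as follows. First make \<open>z\<close> vanish outside \<open>supp v \<union> supp v'\<close> and make every row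
  that is tight at both \<open>v\<close> and \<open>v'\<close> tight at \<open>z\<close>. An edge \<open>{p, p'}\<close> of the joint saturation
  graph then gives \<open>z\<^sub>p + z\<^sub>p' = 1\<close>, so \<open>z\<close> is constant on \<open>X\<close>, with value \<open>c\<close> say. If \<open>c = 0\<close>, the
  support of \<open>z\<close> lies in \<open>supp v'\<close>, so \<open>z \<ge> v'\<close>; if not, \<open>c \<ge> 1\<close>. In both cases the inequality
  \<open>c + z\<^sub>q \<ge> 1\<close> holds for every \<open>q \<in> Y\<close>. Now make these inequalities tight. As \<open>Y\<close> is nonempty,
  \<open>c\<close> is 0 or 1, and \<open>z\<close> agrees with \<open>v'\<close> or \<open>v\<close> respectively outside \<open>supp v \<inter> supp v'\<close>. By
  minimality again \<open>z \<ge> v'\<close> or \<open>z \<ge> v\<close>, so \<open>z\<^sub>i \<ge> 1\<close> for \<open>i \<in> supp v \<inter> supp v'\<close>, and making these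
  inequalities tight as well leaves \<open>v\<close> and \<open>v'\<close> only.\<close>

section \<open>Faces of convex hulls cut out by valid inequalities\<close>

text \<open>A convex combination attains the minimum of a linear functional only if all points with
  positive weight do. In terms of sets: the hull of the minimisers together with the open half-space
  beyond them is convex.\<close>

lemma convex_hull_Int_supporting_hyperplane:
  fixes S :: "'a::euclidean_space set"
  assumes valid: "\<And>z. z \<in> S \<Longrightarrow> b \<le> a \<bullet> z"
  shows "convex hull S \<inter> {x. a \<bullet> x = b} = convex hull {z \<in> S. a \<bullet> z = b}"
proof
  let ?M = "convex hull {z \<in> S. a \<bullet> z = b}"
  have M: "a \<bullet> x = b" if "x \<in> ?M" for x
  proof -
    have "?M \<subseteq> {x. a \<bullet> x = b}"
      by (rule hull_minimal) (auto simp: convex_hyperplane)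
    with that show ?thesis by auto
  qed
  have "convex ({x. b < a \<bullet> x} \<union> ?M)"
  proof (rule convex_alt[THEN iffD2], intro ballI allI impI)
    fix x y and u :: real
    assume x: "x \<in> {x. b < a \<bullet> x} \<union> ?M" and y: "y \<in> {x. b < a \<bullet> x} \<union> ?M"
      and u: "0 \<le> u \<and> u \<le> 1"
    let ?w = "(1 - u) *\<^sub>R x + u *\<^sub>R y"
    consider "x \<in> ?M \<and> y \<in> ?M" | "u = 0" | "u = 1"
      | "b < a \<bullet> x \<or> b < a \<bullet> y" "0 < u" "u < 1"
      using x y u by fastforce
    then show "?w \<in> {x. b < a \<bullet> x} \<union> ?M"
    proof cases
      case 1
      then have "?w \<in> ?M"
        using u convex_convex_hull convexD_alt by blast
      then show ?thesis by simp
    next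
      case 4
      have ge: "b \<le> a \<bullet> x" "b \<le> a \<bullet> y" using x y M by fastforce+
      have "(1 - u) * (a \<bullet> x - b) \<ge> 0" "u * (a \<bullet> y - b) \<ge> 0"
        using ge 4 by simp_all
      moreover have "(1 - u) * (a \<bullet> x - b) > 0 \<or> u * (a \<bullet> y - b) > 0"
        using 4 by auto
      ultimately have "(1 - u) * (a \<bullet> x - b) + u * (a \<bullet> y - b) > 0" by linarith
      then have "b < a \<bullet> ?w" by (simp add: inner_add_right algebra_simps)
      then show ?thesis by simp
    qed (use x y in auto)
  qed
  moreover have "S \<subseteq> {x. b < a \<bullet> x} \<union> ?M"
    using valid by (force intro: hull_inc)
  ultimately have "convex hull S \<subseteq> {x. b < a \<bullet> x} \<union> ?M"
    by (intro hull_minimal)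
  then show "convex hull S \<inter> {x. a \<bullet> x = b} \<subseteq> ?M" by auto
  show "?M \<subseteq> convex hull S \<inter> {x. a \<bullet> x = b}"
    using M hull_mono[of "{z \<in> S. a \<bullet> z = b}" S convex] by auto
qed

text \<open>Finitely many valid inequalities are simultaneously tight exactly where their sum is.\<close>

lemma convex_hull_equality_face_of:
  fixes S :: "'a::euclidean_space set" and a :: "'i \<Rightarrow> 'a"
  assumes fin: "finite I"
    and valid: "\<And>i z. i \<in> I \<Longrightarrow> z \<in> S \<Longrightarrow> b i \<le> a i \<bullet> z"
  shows "convex hull {z \<in> S. \<forall>i\<in>I. a i \<bullet> z = b i} face_of convex hull S"
proof -
  let ?a = "\<Sum>i\<in>I. a i" and ?b = "\<Sum>i\<in>I. b i"
  have le: "?b \<le> ?a \<bullet> z" if "z \<in> S" for z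
    using that valid by (simp add: inner_sum_left sum_mono)
  have "?a \<bullet> z = ?b \<longleftrightarrow> (\<forall>i\<in>I. a i \<bullet> z = b i)" if "z \<in> S" for z
  proof -
    have "?a \<bullet> z = ?b \<longleftrightarrow> (\<Sum>i\<in>I. a i \<bullet> z - b i) = 0"
      by (simp add: inner_sum_left sum_subtractf)
    also have "\<dots> \<longleftrightarrow> (\<forall>i\<in>I. a i \<bullet> z - b i = 0)"
      using fin valid that by (intro sum_nonneg_eq_0_iff) auto
    finally show ?thesis by simp
  qed
  then have "{z \<in> S. \<forall>i\<in>I. a i \<bullet> z = b i} = {z \<in> S. ?a \<bullet> z = ?b}" by blast
  moreover have "convex hull {z \<in> S. ?a \<bullet> z = ?b} = convex hull S \<inter> {x. ?a \<bullet> x = ?b}"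
    using le by (intro convex_hull_Int_supporting_hyperplane[symmetric])
  moreover have "?b \<le> ?a \<bullet> x" if "x \<in> convex hull S" for x
  proof -
    have "convex hull S \<subseteq> {x. ?b \<le> ?a \<bullet> x}"
      using le by (intro hull_minimal) (auto simp: convex_halfspace_ge)
    with that show ?thesis by auto
  qed
  ultimately show ?thesis
    using face_of_Int_supporting_hyperplane_ge[OF convex_convex_hull, of S ?b ?a] by simp
qed

section \<open>Integer covers and vertices\<close>

definition integer_covers :: "real ^ 'n ^ 'm \<Rightarrow> (real ^ 'n) set" where
  "integer_covers A = {x. (\<forall>i. x $ i \<in> \<int>) \<and> A *v x \<ge> 1 \<and> x \<ge> 0}"

lemma set_covering_polyhedron_eq: "set_covering_polyhedron A = convex hull integer_covers A"
  by (simp add: set_covering_polyhedron_def integer_covers_def)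

lemma integer_covers_iff:
  "z \<in> integer_covers A \<longleftrightarrow> (\<forall>i. z $ i \<in> \<int>) \<and> (\<forall>t. 1 \<le> row t A \<bullet> z) \<and> (\<forall>i. 0 \<le> z $ i)"
  by (simp add: integer_covers_def less_eq_vec_def matrix_vector_mul_component row_def
      vec_lambda_eta)

lemma Ints_ge_1:
  fixes x :: real
  assumes "x \<in> \<int>" "0 \<le> x" "x \<noteq> 0"
  shows "1 \<le> x"
  using assms by (auto elim!: Ints_cases)

lemma row_zero_one: "zero_one_matrix A \<Longrightarrow> row t A $ j = 0 \<or> row t A $ j = 1"
  by (auto simp: zero_one_matrix_def row_def)

lemma integer_covers_ge_1: "z \<in> integer_covers A \<Longrightarrow> i \<in> supp z \<Longrightarrow> 1 \<le> z $ i"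
  using Ints_ge_1[of "z $ i"] by (auto simp: integer_covers_iff supp_def)

text \<open>Integrality turns nonzero entries into entries of at least 1, so whether a row is covered depends
  only on whether it meets the support.\<close>

lemma integer_covers_supp_mono:
  assumes A: "zero_one_matrix A" and z: "z \<in> integer_covers A"
    and w: "\<And>i. w $ i \<in> \<int>" "\<And>i. 0 \<le> w $ i" and sub: "supp z \<subseteq> supp w"
  shows "w \<in> integer_covers A"
proof -
  have "1 \<le> row t A \<bullet> w" for t
  proof -
    have "row t A \<bullet> z \<noteq> 0" using z by (auto simp: integer_covers_iff dest: spec[of _ t])
    then obtain j where "row t A $ j * z $ j \<noteq> 0"
      unfolding inner_vec_def inner_real_def by (meson sum.neutral)
    then have j: "row t A $ j = 1" "j \<in> supp w"
      using row_zero_one[OF A, of t j] sub by (auto simp: supp_def)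
    have "1 \<le> w $ j" using Ints_ge_1[of "w $ j"] w j by (auto simp: supp_def)
    also have "\<dots> = row t A $ j * w $ j" using j by simp
    also have "\<dots> \<le> (\<Sum>j\<in>UNIV. row t A $ j * w $ j)"
    proof (rule member_le_sum)
      show "0 \<le> row t A $ k * w $ k" for k
        using w(2)[of k] row_zero_one[OF A, of t k] by auto
    qed simp_all
    finally show ?thesis by (simp add: inner_vec_def)
  qed
  with w show ?thesis by (simp add: integer_covers_iff)
qed

text \<open>Otherwise \<open>v\<close> would be the midpoint of \<open>v - e\<^sub>i\<close> and \<open>v + e\<^sub>i\<close>, both in the polyhedron.\<close>

lemma vertex_minus_axis_notin:
  assumes A: "zero_one_matrix A" and v: "v extreme_point_of set_covering_polyhedron A"
  shows "v - axis i 1 \<notin> integer_covers A"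
proof
  assume minus: "v - axis i 1 \<in> integer_covers A"
  have vi: "v \<in> integer_covers A"
    using v by (simp add: set_covering_polyhedron_eq extreme_point_of_convex_hull)
  have plus: "v + axis i 1 \<in> integer_covers A"
  proof (rule integer_covers_supp_mono[OF A vi])
    show "(v + axis i 1) $ j \<in> \<int>" "0 \<le> (v + axis i 1) $ j" for j
      using vi by (auto simp: integer_covers_iff axis_def)
    show "supp v \<subseteq> supp (v + axis i 1)"
    proof
      fix j assume j: "j \<in> supp v"
      then have "1 \<le> v $ j" by (rule integer_covers_ge_1[OF vi])
      then show "j \<in> supp (v + axis i 1)" by (auto simp: supp_def axis_def)
    qed
  qed
  have "v \<in> open_segment (v - axis i 1) (v + axis i 1)"
  proof -
    have "(v - axis i 1) $ i \<noteq> (v + axis i 1) $ i" by (simp add: axis_def)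
    then have "v - axis i 1 \<noteq> v + axis i 1" by metis
    moreover have "midpoint (v - axis i 1) (v + axis i (1::real)) = v"
      by (simp add: midpoint_def scaleR_2[symmetric])
    ultimately show ?thesis
      by (metis midpoint_in_open_segment)
  qed
  with minus plus v show False
    by (auto simp: extreme_point_of_def set_covering_polyhedron_eq intro: hull_inc)
qed

lemma vertex_zero_one:
  assumes A: "zero_one_matrix A" and v: "v extreme_point_of set_covering_polyhedron A"
    and i: "i \<in> supp v"
  shows "v $ i = 1"
proof (rule ccontr)
  assume "v $ i \<noteq> 1"
  have vi: "v \<in> integer_covers A"
    using v by (simp add: set_covering_polyhedron_eq extreme_point_of_convex_hull)
  have ge: "1 \<le> v $ i" by (rule integer_covers_ge_1[OF vi i])
  have "v - axis i 1 \<in> integer_covers A"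
  proof (rule integer_covers_supp_mono[OF A vi])
    show "(v - axis i 1) $ j \<in> \<int>" "0 \<le> (v - axis i 1) $ j" for j
      using vi ge by (auto simp: integer_covers_iff axis_def)
    show "supp v \<subseteq> supp (v - axis i 1)"
      using \<open>v $ i \<noteq> 1\<close> by (auto simp: supp_def axis_def)
  qed
  with vertex_minus_axis_notin[OF A v] show False by blast
qed

text \<open>If \<open>z\<close> missed some \<open>i \<in> supp v\<close>, the vector \<open>v - e\<^sub>i\<close> would still be a cover.\<close>

lemma vertex_le_of_supp_subset:
  assumes A: "zero_one_matrix A" and v: "v extreme_point_of set_covering_polyhedron A"
    and z: "z \<in> integer_covers A" and sub: "supp z \<subseteq> supp v" and i: "i \<in> supp v"
  shows "1 \<le> z $ i"
proof (cases "i \<in> supp z")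
  case True
  then show ?thesis by (rule integer_covers_ge_1[OF z])
next
  case False
  have vi: "v \<in> integer_covers A"
    using v by (simp add: set_covering_polyhedron_eq extreme_point_of_convex_hull)
  have ge: "1 \<le> v $ i" by (rule integer_covers_ge_1[OF vi i])
  have "v - axis i 1 \<in> integer_covers A"
  proof (rule integer_covers_supp_mono[OF A z])
    show "(v - axis i 1) $ j \<in> \<int>" "0 \<le> (v - axis i 1) $ j" for j
      using vi ge by (auto simp: integer_covers_iff axis_def)
    show "supp z \<subseteq> supp (v - axis i 1)"
      using sub False by (auto simp: supp_def axis_def)
  qed
  with vertex_minus_axis_notin[OF A v] show ?thesis by blast
qed

lemma vertex_supp_subset_imp_eq:
  assumes A: "zero_one_matrix A" and v: "v extreme_point_of set_covering_polyhedron A"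
    and v': "v' extreme_point_of set_covering_polyhedron A" and sub: "supp v' \<subseteq> supp v"
  shows "v' = v"
proof -
  have "v' \<in> integer_covers A"
    using v' by (simp add: set_covering_polyhedron_eq extreme_point_of_convex_hull)
  then have "supp v \<subseteq> supp v'"
    using vertex_le_of_supp_subset[OF A v _ sub] by (force simp: supp_def)
  with sub have eq: "supp v = supp v'" by blast
  show ?thesis
  proof (rule vec_eq_iff[THEN iffD2], rule allI)
    fix i
    show "v' $ i = v $ i"
    proof (cases "i \<in> supp v")
      case True
      with eq show ?thesis using vertex_zero_one[OF A v, of i] vertex_zero_one[OF A v', of i] by simp
    next
      case False
      with eq have "i \<notin> supp v'" by simp
      with False show ?thesis by (simp add: supp_def)
    qed
  qed
qed

section \<open>The joint saturation graph\<close>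

lemma row_inner_eq_sum_supp:
  assumes A: "zero_one_matrix A" and zero: "\<And>i. i \<notin> U \<Longrightarrow> z $ i = 0"
  shows "row t A \<bullet> z = (\<Sum>i \<in> supp (row t A) \<inter> U. z $ i)"
proof -
  have "row t A \<bullet> z = (\<Sum>i\<in>UNIV. row t A $ i * z $ i)" by (simp add: inner_vec_def)
  also have "\<dots> = (\<Sum>i \<in> supp (row t A) \<inter> U. row t A $ i * z $ i)"
    by (rule sum.mono_neutral_right) (use zero in \<open>auto simp: supp_def\<close>)
  also have "\<dots> = (\<Sum>i \<in> supp (row t A) \<inter> U. z $ i)"
    by (rule sum.cong) (use row_zero_one[OF A, of t] in \<open>auto simp: supp_def\<close>)
  finally show ?thesis .
qed

text \<open>A row witnessing an edge is tight at both vertices and meets \<open>supp v \<union> supp v'\<close> in the two ends of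
  the edge only.\<close>

lemma joint_saturation_pair_sum:
  assumes A: "zero_one_matrix A"
    and v: "v extreme_point_of set_covering_polyhedron A"
    and v': "v' extreme_point_of set_covering_polyhedron A"
    and zero: "\<And>i. i \<notin> supp v \<union> supp v' \<Longrightarrow> z $ i = 0"
    and tight: "\<And>t. row t A \<bullet> v = 1 \<Longrightarrow> row t A \<bullet> v' = 1 \<Longrightarrow> row t A \<bullet> z = 1"
    and pp': "(p, p') \<in> joint_saturation_pairs A v v'"
  shows "z $ p + z $ p' = 1"
proof -
  from pp' obtain t where p: "p \<in> supp v - supp v'" and p': "p' \<in> supp v' - supp v"
    and t: "supp (row t A) \<inter> supp v = {p}" "supp (row t A) \<inter> supp v' = {p'}"
    unfolding joint_saturation_pairs_def row_supports_def by auto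
  have "row t A \<bullet> v = 1"
    using row_inner_eq_sum_supp[OF A, of "supp v" v t] t vertex_zero_one[OF A v, of p] p
    by (simp add: supp_def)
  moreover have "row t A \<bullet> v' = 1"
    using row_inner_eq_sum_supp[OF A, of "supp v'" v' t] t vertex_zero_one[OF A v', of p'] p'
    by (simp add: supp_def)
  ultimately have "row t A \<bullet> z = 1" by (rule tight)
  moreover have "supp (row t A) \<inter> (supp v \<union> supp v') = {p, p'}" using t by blast
  moreover have "p \<noteq> p'" using p p' by blast
  ultimately show ?thesis
    using row_inner_eq_sum_supp[OF A, of "supp v \<union> supp v'" z t] zero by simp
qed

text \<open>Across an edge, \<open>z\<^sub>i\<close> on the side of \<open>v\<close> equals \<open>1 - z\<^sub>i\<close> on the side of \<open>v'\<close>. Reading \<open>z\<close> this way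
  turns the alternation along a path into constancy.\<close>

lemma joint_saturation_component_constant:
  fixes z :: "real ^ 'n"
  assumes pairs: "\<And>p p'. (p, p') \<in> joint_saturation_pairs A v v' \<Longrightarrow> z $ p + z $ p' = 1"
    and path: "(p, q) \<in> (joint_saturation_edges A v v')\<^sup>*"
  shows "(if p \<in> supp v then z $ p else 1 - z $ p) = (if q \<in> supp v then z $ q else 1 - z $ q)"
  using path
proof (induction rule: rtrancl_induct)
  case base
  show ?case by simp
next
  case (step q r)
  have "(if q \<in> supp v then z $ q else 1 - z $ q) = (if r \<in> supp v then z $ r else 1 - z $ r)"
  proof -
    have side: "x \<in> supp v \<and> x' \<notin> supp v" if "(x, x') \<in> joint_saturation_pairs A v v'" for x x'
      using that by (auto simp: joint_saturation_pairs_def)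
    from step.hyps(2) consider "(q, r) \<in> joint_saturation_pairs A v v'"
      | "(r, q) \<in> joint_saturation_pairs A v v'"
      by (auto simp: joint_saturation_edges_def)
    then show ?thesis
    proof cases
      case 1
      from side[OF 1] pairs[OF 1] show ?thesis by auto
    next
      case 2
      from side[OF 2] pairs[OF 2] show ?thesis by auto
    qed
  qed
  with step.IH show ?case by simp
qed

lemma joint_saturation_edges_commute:
  "joint_saturation_edges A v' v = joint_saturation_edges A v v'"
  by (auto simp: joint_saturation_edges_def joint_saturation_pairs_def)

lemma sym_joint_saturation_edges: "sym (joint_saturation_edges A v v')"
  by (auto simp: joint_saturation_edges_def sym_def)

lemma component_connected:
  assumes K: "K \<in> connected_components V E" and E: "sym E" and pq: "p \<in> K" "q \<in> K"
  shows "(p, q) \<in> E\<^sup>*"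
proof -
  obtain x where "(x, p) \<in> E\<^sup>*" "(x, q) \<in> E\<^sup>*"
    using K pq by (auto simp: connected_components_def elim!: quotientE)
  then show ?thesis
    using sym_rtrancl[OF E] by (meson rtrancl_trans symE)
qed

section \<open>The segment between the two vertices is a face\<close>

text \<open>A chain of faces \<open>F3\<close>, \<open>F2\<close>, \<open>F1\<close>, \<open>F0\<close> ends in the hull of \<open>{v, v'}\<close>. Vertices of \<open>supp v' - supp v\<close>
  outside the component are not controlled by edges; they are handled by \<open>F2\<close>, whose defining
  inequalities are valid on \<open>F1\<close> only by minimality of \<open>v'\<close>.\<close>

lemma closed_segment_face_of_set_covering_polyhedron:
  assumes A: "zero_one_matrix A"
    and v: "v extreme_point_of set_covering_polyhedron A"
    and v': "v' extreme_point_of set_covering_polyhedron A"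
    and neq: "v \<noteq> v'"
    and conn: "\<And>p q. p \<in> supp v - supp v' \<Longrightarrow> q \<in> supp v - supp v' \<Longrightarrow>
      (p, q) \<in> (joint_saturation_edges A v v')\<^sup>*"
  shows "closed_segment v v' face_of set_covering_polyhedron A"
proof -
  define S where "S = integer_covers A"
  have vS: "v \<in> S" "v' \<in> S"
    using v v' by (simp_all add: S_def set_covering_polyhedron_eq extreme_point_of_convex_hull)
  have v1: "v $ i = (if i \<in> supp v then 1 else 0)" for i
    using vertex_zero_one[OF A v, of i] by (simp add: supp_def)
  have v'1: "v' $ i = (if i \<in> supp v' then 1 else 0)" for i
    using vertex_zero_one[OF A v', of i] by (simp add: supp_def)
  obtain p0 where p0: "p0 \<in> supp v" "p0 \<notin> supp v'"
    using vertex_supp_subset_imp_eq[OF A v' v] neq by blast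
  obtain q0 where q0: "q0 \<in> supp v'" "q0 \<notin> supp v"
    using vertex_supp_subset_imp_eq[OF A v v'] neq by blast

  define I where "I = - (supp v \<union> supp v')"
  define T where "T = {t. row t A \<bullet> v = 1 \<and> row t A \<bullet> v' = 1}"
  define Y where "Y = supp v' - supp v"
  define F0 where "F0 = {z \<in> S. \<forall>i\<in>I. axis i 1 \<bullet> z = 0}"
  define F1 where "F1 = {z \<in> F0. \<forall>t\<in>T. row t A \<bullet> z = 1}"
  define F2 where "F2 = {z \<in> F1. \<forall>q\<in>Y. (axis p0 1 + axis q 1) \<bullet> z = 1}"
  define F3 where "F3 = {z \<in> F2. \<forall>i\<in>supp v \<inter> supp v'. axis i 1 \<bullet> z = 1}"
  note coord = inner_axis' inner_add_left
  have S_nonneg: "0 \<le> z $ i" and S_int: "z $ i \<in> \<int>" if "z \<in> S" for z i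
    using that by (auto simp: S_def integer_covers_iff)

  have face0: "convex hull F0 face_of convex hull S"
    unfolding F0_def by (rule convex_hull_equality_face_of) (auto simp: coord S_nonneg)
  have face1: "convex hull F1 face_of convex hull F0"
    unfolding F1_def
    by (rule convex_hull_equality_face_of) (auto simp: F0_def S_def integer_covers_iff)

  have F1_S: "z \<in> S" and F1_zero: "i \<notin> supp v \<union> supp v' \<Longrightarrow> z $ i = 0" if "z \<in> F1" for z i
    using that by (auto simp: F1_def F0_def I_def coord)
  have F1_const: "z $ p = z $ p0" if z: "z \<in> F1" and p: "p \<in> supp v - supp v'" for z p
  proof -
    have "z $ x + z $ x' = 1" if "(x, x') \<in> joint_saturation_pairs A v v'" for x x'
      by (rule joint_saturation_pair_sum[OF A v v' _ _ that])
        (use z F1_zero in \<open>auto simp: F1_def T_def\<close>)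
    from joint_saturation_component_constant[OF this conn[OF p, of p0]] p0 p
    show ?thesis by simp
  qed

  \<comment> \<open>A point with \<open>z\<^sub>p\<^sub>0 = 0\<close> is supported inside \<open>supp v'\<close>, so minimality of \<open>v'\<close> applies.\<close>
  have F1_valid: "1 \<le> z $ p0 + z $ q" if z: "z \<in> F1" and q: "q \<in> Y" for z q
  proof (cases "z $ p0 = 0")
    case True
    then have "supp z \<subseteq> supp v'"
      using F1_zero[OF z] F1_const[OF z] by (force simp: supp_def)
    then show ?thesis
      using vertex_le_of_supp_subset[OF A v', of z q] F1_S[OF z] q True
      by (auto simp: S_def Y_def)
  next
    case False
    then have "1 \<le> z $ p0" using F1_S[OF z] S_int S_nonneg Ints_ge_1 by blast
    then show ?thesis using S_nonneg[OF F1_S[OF z], of q] by linarith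
  qed
  have face2: "convex hull F2 face_of convex hull F1"
    unfolding F2_def by (rule convex_hull_equality_face_of) (auto simp: coord F1_valid)

  have F2_F1: "z \<in> F1" and F2_Y: "q \<in> Y \<Longrightarrow> z $ p0 + z $ q = 1" if "z \<in> F2" for z q
    using that by (auto simp: F2_def coord)
  have F2_cases: "z $ p0 = 0 \<and> supp z \<subseteq> supp v' \<or> z $ p0 = 1 \<and> supp z \<subseteq> supp v" if z: "z \<in> F2" for z
  proof -
    note F1 = F2_F1[OF z]
    have "z $ p0 + z $ q0 = 1" using F2_Y[OF z] q0 by (auto simp: Y_def)
    then have "z $ p0 \<le> 1" using S_nonneg[OF F1_S[OF F1], of q0] by linarith
    then consider "z $ p0 = 0" | "z $ p0 = 1"
      using Ints_ge_1[of "z $ p0"] F1_S[OF F1] S_int S_nonneg by (metis order_antisym)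
    then show ?thesis
    proof cases
      case 1
      then have "supp z \<subseteq> supp v'"
        using F1_zero[OF F1] F1_const[OF F1] by (force simp: supp_def)
      with 1 show ?thesis by simp
    next
      case 2
      then have "supp z \<subseteq> supp v"
        using F1_zero[OF F1] F2_Y[OF z] by (force simp: supp_def Y_def)
      with 2 show ?thesis by simp
    qed
  qed
  \<comment> \<open>This can fail on \<open>F1\<close>: where \<open>z\<close> meets both partite sets, minimality says nothing.\<close>
  have F2_valid: "1 \<le> z $ i" if z: "z \<in> F2" and i: "i \<in> supp v \<inter> supp v'" for z i
    using F2_cases[OF z] vertex_le_of_supp_subset[OF A v, of z i]
      vertex_le_of_supp_subset[OF A v', of z i] F1_S[OF F2_F1[OF z]] i
    by (auto simp: S_def)
  have face3: "convex hull F3 face_of convex hull F2"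
    unfolding F3_def by (rule convex_hull_equality_face_of) (auto simp: coord F2_valid)

  have "z = v \<or> z = v'" if z: "z \<in> F3" for z
  proof -
    have F2: "z \<in> F2" and common: "\<And>i. i \<in> supp v \<inter> supp v' \<Longrightarrow> z $ i = 1"
      using z by (auto simp: F3_def coord)
    note F1 = F2_F1[OF F2]
    have X: "z $ i = z $ p0" if "i \<in> supp v" "i \<notin> supp v'" for i
      using F1_const[OF F1] that by blast
    have Y: "z $ i = 1 - z $ p0" if "i \<in> supp v'" "i \<notin> supp v" for i
      using F2_Y[OF F2, of i] that by (auto simp: Y_def)
    from F2_cases[OF F2] show ?thesis
    proof (elim disjE conjE)
      assume "z $ p0 = 0"
      then have "z $ i = v' $ i" for i
        unfolding v'1 using common X Y F1_zero[OF F1] by (cases "i \<in> supp v") auto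
      then show ?thesis by (simp add: vec_eq_iff)
    next
      assume "z $ p0 = 1"
      then have "z $ i = v $ i" for i
        unfolding v1 using common X Y F1_zero[OF F1] by (cases "i \<in> supp v") auto
      then show ?thesis by (simp add: vec_eq_iff)
    qed
  qed
  moreover have "v \<in> F3" "v' \<in> F3"
    using vS p0 by (auto simp: F3_def F2_def F1_def F0_def I_def T_def Y_def coord v1 v'1)
  ultimately have "F3 = {v, v'}" by blast
  then have "closed_segment v v' = convex hull F3" by (simp add: segment_convex_hull)
  moreover have "convex hull F3 face_of convex hull S"
    using face0 face1 face2 face3 by (meson face_of_trans)
  ultimately show ?thesis by (simp add: set_covering_polyhedron_eq S_def)
qed

theorem theorem4p3:
  fixes A :: "real ^ 'n ^ 'm" and v v' :: "real ^ 'n"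
  assumes "zero_one_matrix A" and "standing_assumptions A"
    and "v extreme_point_of set_covering_polyhedron A"
    and "v' extreme_point_of set_covering_polyhedron A"
    and "v \<noteq> v'"
    and "partite_connected (supp v - supp v') (supp v' - supp v) (joint_saturation_edges A v v')"
  shows "adjacent_vertices (set_covering_polyhedron A) v v'"
proof -
  let ?E = "joint_saturation_edges A v v'"
  obtain K where K: "K \<in> connected_components ((supp v - supp v') \<union> (supp v' - supp v)) ?E"
    and sub: "supp v - supp v' \<subseteq> K \<or> supp v' - supp v \<subseteq> K"
    using assms(6) unfolding partite_connected_def by blast
  note conn = component_connected[OF K sym_joint_saturation_edges]
  from sub have "closed_segment v v' face_of set_covering_polyhedron A"
  proof
    assume "supp v - supp v' \<subseteq> K"
    then show ?thesis
      by (intro closed_segment_face_of_set_covering_polyhedron assms conn) auto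
  next
    assume "supp v' - supp v \<subseteq> K"
    then have "closed_segment v' v face_of set_covering_polyhedron A"
      by (intro closed_segment_face_of_set_covering_polyhedron assms assms(5)[symmetric])
        (auto simp: joint_saturation_edges_commute[of A v' v] intro!: conn)
    then show ?thesis by (simp add: closed_segment_commute)
  qed
  moreover have "aff_dim (closed_segment v v') = 1"
    using assms(5) by (simp add: segment_convex_hull aff_dim_convex_hull aff_dim_2)
  ultimately show ?thesis
    using assms(3,4) by (simp add: adjacent_vertices_def edge_of_def)
qed

end
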